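(* Let $n \ge 3$ be an integer and let $P$ be a parallelogram in the Euclidean plane with edge lengths $1$ and $2$ and interior angles $\frac{2\pi}{n}$ and $\frac{(n-2)\pi}{n}$. Then the angles between the longer diagonal of $P$ and the edges of $P$ are irrational.
   Context: An angle $\theta\in[0,2\pi)$ is called irrational if $\theta\notin\pi\mathbb{Q}$, i.e. $\theta$ is not a rational multiple of $\pi$. For $n=4$ the parallelogram is a rectangle and its two diagonals have equal length; "the longer diagonal" then means either diagonal. *)

theory Defs
  imports "HOL-Analysis.Analysis"
begin

text \<open>
  The unoriented angle \<open>X Y Z\<close> at the vertex \<open>Y\<close>, in \<open>{0..pi}\<close>; only meaningful
  for \<open>X \<noteq> Y\<close> and \<open>Z \<noteq> Y\<close>.
\<close>

definition vertex_angle :: "real^2 \<Rightarrow> real^2 \<Rightarrow> real^2 \<Rightarrow> real" where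
  "vertex_angle X Y Z = arccos (((X - Y) \<bullet> (Z - Y)) / (norm (X - Y) * norm (Z - Y)))"

definition irrational_angle :: "real \<Rightarrow> bool" where
  "irrational_angle \<theta> \<longleftrightarrow> 0 \<le> \<theta> \<and> \<theta> < 2 * pi \<and> (\<forall>q\<in>\<rat>. \<theta> \<noteq> q * pi)"

text \<open>
  The vertices are listed in cyclic order, so the edges are \<open>A B\<close>, \<open>B C\<close>, \<open>C D\<close>, \<open>D A\<close>
  and the diagonals are \<open>A C\<close> and \<open>B D\<close>. Degenerate parallelograms are excluded.
\<close>

definition parallelogram :: "real^2 \<Rightarrow> real^2 \<Rightarrow> real^2 \<Rightarrow> real^2 \<Rightarrow> bool" where
  "parallelogram A B C D \<longleftrightarrow> B - A = C - D \<and> \<not> collinear {A, B, C}"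

definition edge_lengths :: "real^2 \<Rightarrow> real^2 \<Rightarrow> real^2 \<Rightarrow> real^2 \<Rightarrow> real set" where
  "edge_lengths A B C D = {dist A B, dist B C, dist C D, dist D A}"

text \<open>
  For a convex quadrilateral, such as a parallelogram, the interior angle at a vertex is
  the unoriented angle between the two edges meeting there.
\<close>

definition interior_angles :: "real^2 \<Rightarrow> real^2 \<Rightarrow> real^2 \<Rightarrow> real^2 \<Rightarrow> real set" where
  "interior_angles A B C D =
     {vertex_angle D A B, vertex_angle A B C, vertex_angle B C D, vertex_angle C D A}"

text \<open>
  The angles between the diagonal \<open>A C\<close> and the four edges, each measured at the vertex
  that the edge shares with the diagonal. For the other diagonal, rotate the vertices.
\<close>

definition diagonal_edge_angles :: "real^2 \<Rightarrow> real^2 \<Rightarrow> real^2 \<Rightarrow> real^2 \<Rightarrow> real set" where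
  "diagonal_edge_angles A B C D =
     {vertex_angle C A B, vertex_angle C A D, vertex_angle A C B, vertex_angle A C D}"

end

theory Submission
  imports Defs
begin

text \<open>
  Let \<open>\<alpha>\<close> be the non-obtuse interior angle, \<open>\<zeta> = cis \<alpha>\<close>. The longer diagonal joins the two vertices
  with angle \<open>\<alpha>\<close>, and \<open>\<alpha> = 2 * pi / m\<close> for some \<open>m \<ge> 4\<close>: take \<open>m = n\<close>, except that \<open>n = 3\<close> has
  the angle \<open>pi / 3\<close> and gives \<open>m = 6\<close>. With the side of length 2, or of length 1, along the
  positive real axis, the diagonal is \<open>2 + \<zeta>\<close>, or \<open>1 + 2 * \<zeta>\<close>. If its argument is a rational
  multiple of \<open>pi\<close>, the quotient of the number by its conjugate is a root of unity. The two
  quotients multiply to \<open>\<zeta>\<^sup>2\<close>, so in either case \<open>\<omega> = (2 + \<zeta>) / (2 + inverse \<zeta>)\<close> is a root of unity.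

  The contradiction comes from reducing \<open>2 + \<zeta> = \<omega> * (2 + inverse \<zeta>)\<close> modulo 2 in a ring of
  algebraic integers: \<open>\<omega>\<close> is congruent to \<open>\<zeta>\<^sup>2\<close>, so the root of unity \<open>\<omega> / \<zeta>\<^sup>2\<close> is congruent to 1.
  The only such roots of unity are 1 and -1 (\<open>root_of_unity_cong_1_mod_2\<close>). Substituting
  \<open>\<omega> = \<zeta>\<^sup>2\<close> and \<open>\<omega> = - \<zeta>\<^sup>2\<close> back into the relation gives \<open>\<zeta>\<^sup>2 = 1\<close> and \<open>1 + \<zeta> + \<zeta>\<^sup>2 = 0\<close>
  respectively, so the order of \<open>\<zeta>\<close> is at most 3, whereas it is \<open>m \<ge> 4\<close>.

  The one fact about algebraic integers that this uses is that 1/2 is not an integer combination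
  of roots of unity (\<open>half_notin_root_ring\<close>), a case of Nakayama's lemma that Gaussian
  elimination proves directly (\<open>odd_diagonal_system_trivial\<close>).
\<close>

section \<open>Integer systems that are the identity modulo 2\<close>

text \<open>
  The coefficient matrix is the identity modulo 2, so its determinant is odd and hence nonzero.
  Fraction-free elimination of one unknown keeps the parity pattern, which gives an induction on
  the number of unknowns without determinants.
\<close>

lemma odd_diagonal_system_trivial:
  fixes x :: "'i \<Rightarrow> complex" and a :: "'i \<Rightarrow> 'i \<Rightarrow> int"
  assumes "finite I"
    and "\<And>i. i \<in> I \<Longrightarrow> odd (a i i)"
    and "\<And>i j. i \<in> I \<Longrightarrow> j \<in> I \<Longrightarrow> i \<noteq> j \<Longrightarrow> even (a i j)"
    and "\<And>i. i \<in> I \<Longrightarrow> (\<Sum>j\<in>I. of_int (a i j) * x j) = 0"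
    and "i \<in> I"
  shows "x i = 0"
  using assms
proof (induction I arbitrary: a i rule: finite_induct)
  case empty
  then show ?case by simp
next
  case (insert p I)
  \<comment> \<open>the rows left after cross-multiplying with row \<open>p\<close> to eliminate the unknown \<open>x p\<close>\<close>
  define b where "b i j = a p p * a i j - a i p * a p j" for i j
  have row: "of_int (a i p) * x p + (\<Sum>j\<in>I. of_int (a i j) * x j) = 0" if "i \<in> insert p I" for i
    using insert.prems(3)[OF that] insert.hyps by simp
  have zero: "x j = 0" if "j \<in> I" for j
  proof (rule insert.IH[of b])
    show "odd (b i i)" if "i \<in> I" for i
    proof -
      have "odd (a p p)" "odd (a i i)" "even (a i p)"
        using insert.prems(1,2) insert.hyps that by auto
      then show ?thesis by (simp add: b_def)
    qed
    show "even (b i j)" if "i \<in> I" "j \<in> I" "i \<noteq> j" for i j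
    proof -
      have "even (a i j)" "even (a i p)"
        using insert.prems(2) insert.hyps that by auto
      then show ?thesis by (simp add: b_def)
    qed
    show "(\<Sum>j\<in>I. of_int (b i j) * x j) = 0" if "i \<in> I" for i
    proof -
      have "(\<Sum>j\<in>I. of_int (b i j) * x j) =
          of_int (a p p) * (\<Sum>j\<in>I. of_int (a i j) * x j)
          - of_int (a i p) * (\<Sum>j\<in>I. of_int (a p j) * x j)"
        by (simp add: b_def sum_distrib_left sum_subtractf algebra_simps)
      also have "\<dots> = of_int (a p p) * (- of_int (a i p) * x p)
          - of_int (a i p) * (- of_int (a p p) * x p)"
        using row[of i] row[of p] that by (simp add: add_eq_0_iff)
      finally show ?thesis by simp
    qed
    show "j \<in> I" by (fact that)
  qed
  have "odd (a p p)" using insert.prems(1) by simp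
  then have "a p p \<noteq> 0" by auto
  moreover have "of_int (a p p) * x p = 0"
    using row[of p] zero by simp
  ultimately have "x p = 0" by simp
  then show ?case using zero insert.prems(4) by auto
qed

section \<open>The ring generated by the roots of unity of a given order\<close>

interpretation int_module: module "\<lambda>(c::int) (z::complex). of_int c * z"
  by unfold_locales (simp_all add: algebra_simps)

text \<open>
  For \<open>K > 0\<close> this is the ring of integers of the cyclotomic field of order \<open>K\<close>. Taking the span of
  all roots of order dividing \<open>K\<close> puts two given roots of unity in one ring without choosing a
  primitive root.
\<close>

definition root_ring :: "nat \<Rightarrow> complex set" where
  "root_ring K = int_module.span {z. z ^ K = 1}"

lemma root_ring_root: "z ^ K = 1 \<Longrightarrow> z \<in> root_ring K"
  unfolding root_ring_def by (rule int_module.span_base) simp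

lemma root_ring_add: "x \<in> root_ring K \<Longrightarrow> y \<in> root_ring K \<Longrightarrow> x + y \<in> root_ring K"
  unfolding root_ring_def by (rule int_module.span_add)

lemma root_ring_diff: "x \<in> root_ring K \<Longrightarrow> y \<in> root_ring K \<Longrightarrow> x - y \<in> root_ring K"
  unfolding root_ring_def by (rule int_module.span_diff)

lemma root_ring_sum: "(\<And>i. i \<in> A \<Longrightarrow> f i \<in> root_ring K) \<Longrightarrow> sum f A \<in> root_ring K"
  unfolding root_ring_def by (rule int_module.span_sum)

lemma root_ring_of_int: "of_int c \<in> root_ring K"
  using int_module.span_scale[of 1 "{z. z ^ K = 1}" c] root_ring_root[of 1 K]
  by (simp add: root_ring_def)

lemma root_ring_mult:
  assumes "x \<in> root_ring K" "y \<in> root_ring K"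
  shows "x * y \<in> root_ring K"
proof -
  have scaled: "z * y \<in> root_ring K" if z: "z ^ K = 1" for z
    using assms(2) unfolding root_ring_def
  proof (induction y rule: int_module.span_induct_alt)
    case base
    then show ?case by (simp add: int_module.span_zero)
  next
    case (step c g y)
    have "z * g \<in> int_module.span {z. z ^ K = 1}"
      using z step.hyps by (intro int_module.span_base) (simp add: power_mult_distrib)
    then have "of_int c * (z * g) + z * y \<in> int_module.span {z. z ^ K = 1}"
      by (intro int_module.span_add int_module.span_scale step.IH)
    then show ?case by (simp add: algebra_simps)
  qed
  show ?thesis using assms(1) unfolding root_ring_def
  proof (induction x rule: int_module.span_induct_alt)
    case base
    then show ?case by (simp add: int_module.span_zero)
  next
    case (step c g x)
    have "g * y \<in> int_module.span {z. z ^ K = 1}"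
      using scaled step.hyps by (simp add: root_ring_def)
    then have "of_int c * (g * y) + x * y \<in> int_module.span {z. z ^ K = 1}"
      by (intro int_module.span_add int_module.span_scale step.IH)
    then show ?case by (simp add: algebra_simps)
  qed
qed

text \<open>
  If 1/2 were an integer combination of the roots \<open>h\<close>, multiplying by any root \<open>g\<close> would express \<open>g\<close>
  as an even combination of the roots. The vector of all roots would then be a nonzero solution of
  an integer system that is the identity modulo 2.
\<close>

lemma half_notin_root_ring:
  assumes "K > 0"
  shows "1 / 2 \<notin> root_ring K"
proof
  define G where "G = {z::complex. z ^ K = 1}"
  have fin: "finite G" unfolding G_def using assms by (intro finite_roots_unity) simp
  have nz: "g \<noteq> 0" if "g \<in> G" for g using that assms by (auto simp: G_def zero_power)
  assume "1 / 2 \<in> root_ring K"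
  then obtain c where c: "(1 / 2 :: complex) = (\<Sum>h\<in>G. of_int (c h) * h)"
    using int_module.span_finite[OF fin] by (auto simp: root_ring_def G_def)
  define a where "a g k = (if g = k then 1 else 0) - 2 * c (k / g)" for g k
  have "(1::complex) = 0"
  proof (rule odd_diagonal_system_trivial[of G a "\<lambda>g. g" 1])
    show "(\<Sum>k\<in>G. of_int (a g k) * k) = 0" if g: "g \<in> G" for g
    proof -
      have "bij_betw (\<lambda>h. h * g) G G"
        by (rule bij_betw_byWitness[where f' = "\<lambda>k. k / g"])
          (use g nz in \<open>auto simp: G_def power_mult_distrib power_divide\<close>)
      then have "(\<Sum>k\<in>G. of_int (c (k / g)) * k) = (\<Sum>h\<in>G. of_int (c (h * g / g)) * (h * g))"
        by (rule sum.reindex_bij_betw[symmetric])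
      also have "\<dots> = (\<Sum>h\<in>G. of_int (c h) * h) * g"
        using nz[OF g] by (simp add: sum_distrib_right mult.assoc)
      also have "\<dots> = g / 2" using c by simp
      finally have *: "(\<Sum>k\<in>G. of_int (c (k / g)) * k) = g / 2" .
      have "(\<Sum>k\<in>G. of_int (a g k) * k) =
          (\<Sum>k\<in>G. if g = k then k else 0) - 2 * (\<Sum>k\<in>G. of_int (c (k / g)) * k)"
        unfolding sum_distrib_left sum_subtractf[symmetric]
        by (rule sum.cong) (auto simp: a_def algebra_simps)
      also have "\<dots> = 0" unfolding * using fin g by simp
      finally show ?thesis .
    qed
  qed (use fin in \<open>auto simp: a_def G_def\<close>)
  then show False by simp
qed

section \<open>Roots of unity congruent to 1 modulo 2\<close>

text \<open>
  All powers of \<open>v\<close> are congruent to 1 modulo 2. Hence if \<open>y \<noteq> 1\<close> is a power of \<open>v\<close> with \<open>y ^ m = 1\<close> and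
  \<open>m\<close> odd, the vanishing sum of \<open>y ^ j\<close> over \<open>j < m\<close> would be congruent to the odd number \<open>m\<close>; so the
  order of \<open>v\<close> is a power of 2. If it were divisible by 4, a square root of -1 would have the form
  \<open>1 + 2 * b\<close>, which forces \<open>b\<^sup>2 + b = - 1 / 2\<close>. Both contradict \<open>half_notin_root_ring\<close>.
\<close>

lemma root_of_unity_cong_1_mod_2:
  assumes "K > 0" and vK: "v ^ K = 1" and v1: "(v - 1) / 2 \<in> root_ring K"
  shows "v = 1 \<or> v = -1"
proof -
  have vS: "v \<in> root_ring K" by (rule root_ring_root[OF vK])
  have pow: "(v ^ j - 1) / 2 \<in> root_ring K" for j
  proof (induction j)
    case 0
    show ?case using root_ring_of_int[of 0] by simp
  next
    case (Suc j)
    have "v * ((v ^ j - 1) / 2) + (v - 1) / 2 \<in> root_ring K"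
      by (intro root_ring_add root_ring_mult vS Suc v1)
    then show ?case by (simp add: algebra_simps diff_divide_distrib)
  qed
  have odd_half: "of_int c / 2 \<notin> root_ring K" if c: "odd c" for c
  proof
    assume half: "of_int c / 2 \<in> root_ring K"
    from c obtain t where t: "c = 2 * t + 1" by (auto elim: oddE)
    have "of_int c / 2 - of_int t = (1 / 2 :: complex)" by (simp add: t field_simps)
    then have "1 / 2 \<in> root_ring K"
      using root_ring_diff[OF half root_ring_of_int[of t]] by (simp only:)
    then show False using half_notin_root_ring[OF \<open>K > 0\<close>] by blast
  qed
  define e where "e = multiplicity 2 K"
  obtain m where K: "K = 2 ^ e * m" and m: "odd m"
    unfolding e_def using multiplicity_decompose'[of K 2] \<open>K > 0\<close> by auto
  define y where "y = v ^ 2 ^ e"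
  have "y = 1"
  proof (rule ccontr)
    assume "y \<noteq> 1"
    have "y ^ m = 1" using vK by (simp add: y_def K mult.commute flip: power_mult)
    then have "(\<Sum>j<m. y ^ j) = 0" using \<open>y \<noteq> 1\<close> by (simp add: geometric_sum)
    then have "(\<Sum>j<m. (y ^ j - 1) / 2) = of_int (- int m) / 2"
      by (simp add: sum_subtractf flip: sum_divide_distrib)
    moreover have "(\<Sum>j<m. (y ^ j - 1) / 2) \<in> root_ring K"
      by (intro root_ring_sum) (simp add: y_def pow flip: power_mult)
    ultimately show False using odd_half[of "- int m"] m by simp
  qed
  then have "v ^ 2 ^ e = 1" by (simp add: y_def)
  then show ?thesis
  proof (induction e)
    case 0
    then show ?case by simp
  next
    case (Suc e)
    have "(v ^ 2 ^ e)\<^sup>2 = 1" using Suc.prems by (simp add: mult.commute flip: power_mult)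
    then consider "v ^ 2 ^ e = 1" | "v ^ 2 ^ e = -1" by (auto simp: power2_eq_1_iff)
    then show ?case
    proof cases
      case 1
      then show ?thesis by (rule Suc.IH)
    next
      case 2
      show ?thesis
      proof (cases e)
        case 0
        then show ?thesis using 2 by simp
      next
        case (Suc f)
        define b where "b = (v ^ 2 ^ f - 1) / 2"
        have "(v ^ 2 ^ f)\<^sup>2 = -1" using 2 Suc by (simp add: mult.commute flip: power_mult)
        then have "b * b + b = of_int (-1) / 2"
          by (simp add: b_def field_simps power2_eq_square)
        moreover have "b * b + b \<in> root_ring K"
          using pow[of "2 ^ f"] by (intro root_ring_add root_ring_mult) (simp_all add: b_def)
        ultimately show ?thesis using odd_half[of "-1"] by simp
      qed
    qed
  qed
qed

section \<open>The quotient of a diagonal by its conjugate\<close>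

text \<open>
  The relation says that \<open>\<omega> - \<zeta>\<^sup>2\<close> is \<open>2 * \<zeta> * (1 - \<omega>)\<close>, so \<open>\<omega> / \<zeta>\<^sup>2\<close> is a root of unity congruent
  to 1 modulo 2. The order 3 does occur: \<open>2 + cis (2 * pi / 3)\<close> has argument \<open>pi / 6\<close>, and is the
  shorter diagonal of the parallelogram with angle \<open>pi / 3\<close>.
\<close>

lemma diagonal_quotient_root_of_unity_imp_small_order:
  assumes "K > 0" and "\<zeta> ^ K = 1" and "\<omega> ^ K = 1"
    and rel: "2 + \<zeta> = \<omega> * (2 + inverse \<zeta>)"
  shows "\<zeta> ^ 2 = 1 \<or> \<zeta> ^ 3 = (1::complex)"
proof -
  have nz: "\<zeta> \<noteq> 0" using assms(1,2) by (auto simp: zero_power)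
  define v where "v = \<omega> / \<zeta> ^ 2"
  have "v ^ K = 1"
    using assms(2,3) unfolding v_def power_divide power_mult[symmetric] mult.commute[of 2 K]
    by (simp add: power_mult)
  moreover have "(v - 1) / 2 \<in> root_ring K"
  proof -
    have "\<omega> - \<zeta> ^ 2 = 2 * \<zeta> * (1 - \<omega>)"
      using rel nz by (simp add: field_simps power2_eq_square)
    moreover have "v - 1 = (\<omega> - \<zeta> ^ 2) / \<zeta> ^ 2"
      using nz by (simp add: v_def diff_divide_distrib)
    ultimately have "(v - 1) / 2 = (1 - \<omega>) / \<zeta>"
      using nz by (simp add: power2_eq_square del: right_diff_distrib_numeral)
    also have "\<dots> = inverse \<zeta> - \<omega> * inverse \<zeta>"
      by (simp add: divide_inverse left_diff_distrib)
    also have "\<dots> \<in> root_ring K"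
      using assms(2,3)
      by (intro root_ring_diff root_ring_root) (simp_all add: power_mult_distrib power_inverse)
    finally show ?thesis .
  qed
  ultimately have "v = 1 \<or> v = -1"
    using root_of_unity_cong_1_mod_2[OF \<open>K > 0\<close>] by blast
  then show ?thesis
  proof
    assume "v = 1"
    then have "\<omega> = \<zeta> ^ 2" using nz by (simp add: v_def field_simps)
    then have "2 + \<zeta> = 2 * \<zeta> ^ 2 + \<zeta>" using rel nz by (simp add: field_simps power2_eq_square)
    then show ?thesis by simp
  next
    assume "v = -1"
    then have "\<omega> = - (\<zeta> ^ 2)" using nz by (simp add: v_def field_simps)
    then have "\<omega> * (2 + inverse \<zeta>) = - 2 * \<zeta> ^ 2 - \<zeta>"
      using nz by (simp add: field_simps power2_eq_square)
    then have "2 + \<zeta> = - 2 * \<zeta> ^ 2 - \<zeta>" using rel by simp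
    then have "2 * (1 + \<zeta> + \<zeta> ^ 2) = 0" by algebra
    then have "1 + \<zeta> + \<zeta> ^ 2 = 0" by (simp del: distrib_left_numeral)
    then have "\<zeta> ^ 3 = 1" by algebra
    then show ?thesis ..
  qed
qed

section \<open>Rational arguments and roots of unity\<close>

text \<open>
  The quotient \<open>z / cnj z\<close> is the square of \<open>sgn z\<close>, so its argument is twice that of \<open>z\<close>. The
  arccosine determines the argument only up to sign, which does not affect the order.
\<close>

lemma rational_argument_imp_root_of_unity:
  assumes z: "z \<noteq> 0" and q: "q \<in> \<rat>" and arg: "arccos (Re z / cmod z) = q * pi"
  shows "\<exists>k>0. (z / cnj z) ^ k = 1"
proof -
  define \<theta> where "\<theta> = arccos (Re z / cmod z)"
  have bounds: "\<bar>Re z / cmod z\<bar> \<le> 1"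
    using abs_Re_le_cmod[of z] z by (simp add: abs_divide)
  have cos: "cos \<theta> = Re (sgn z)"
    using bounds by (simp add: \<theta>_def cos_arccos_abs Re_sgn)
  have "cmod (sgn z) = 1" using z by (simp add: norm_sgn)
  then have "Re (sgn z) ^ 2 + Im (sgn z) ^ 2 = 1"
    by (metis cmod_power2 one_power2)
  then have "Im (sgn z) ^ 2 = sin \<theta> ^ 2"
    using cos sin_cos_squared_add[of \<theta>] by simp
  then have "Im (sgn z) = sin \<theta> \<or> Im (sgn z) = - sin \<theta>"
    by (simp add: power2_eq_iff)
  then have "sgn z = cis \<theta> \<or> sgn z = cis (- \<theta>)"
    using cos by (auto simp: complex_eq_iff)
  then obtain s :: int where s: "sgn z = cis (of_int s * \<theta>)"
    by (metis minus_mult_minus mult_1 mult_minus_left of_int_1 of_int_minus)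
  have "z / cnj z = sgn z ^ 2"
    using z by (simp add: sgn_eq power_divide complex_div_cnj[of z "cnj z"] power2_eq_square)
  then have quot: "z / cnj z = cis (2 * (of_int s * \<theta>))"
    by (simp add: s Complex.DeMoivre)
  obtain a b :: int where ab: "b > 0" "q = of_int a / of_int b"
    using q by (metis Rats_cases')
  have "real (nat b) * (2 * (of_int s * \<theta>)) = 2 * pi * (of_int s * (q * of_int b))"
    using ab(1) by (simp add: \<theta>_def arg)
  also have "\<dots> = 2 * pi * of_int (s * a)" using ab by simp
  finally have "(z / cnj z) ^ nat b = cis (2 * pi * of_int (s * a))"
    unfolding quot Complex.DeMoivre by (rule arg_cong)
  then have "(z / cnj z) ^ nat b = 1" by (simp only: cis_multiple_2pi Ints_of_int)
  then show ?thesis using ab(1) by (intro exI[of _ "nat b"]) simp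
qed

lemma diagonal_quotient_not_root_of_unity:
  fixes m k :: nat
  assumes m: "m \<ge> 4" and k: "k > 0"
  defines "\<zeta> \<equiv> cis (2 * pi / real m)"
  shows "((2 + \<zeta>) / (2 + inverse \<zeta>)) ^ k \<noteq> 1"
proof
  define \<omega> where "\<omega> = (2 + \<zeta>) / (2 + inverse \<zeta>)"
  assume "((2 + \<zeta>) / (2 + inverse \<zeta>)) ^ k = 1"
  then have \<omega>: "\<omega> ^ k = 1" by (simp add: \<omega>_def)
  then have nz: "2 + inverse \<zeta> \<noteq> 0" using k by (auto simp: \<omega>_def zero_power)
  have \<zeta>: "\<zeta> ^ m = 1"
    unfolding \<zeta>_def Complex.DeMoivre using m by simp
  have "\<zeta> ^ 2 = 1 \<or> \<zeta> ^ 3 = 1"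
  proof (rule diagonal_quotient_root_of_unity_imp_small_order[of "m * k" \<zeta> \<omega>])
    show "m * k > 0" using m k by simp
    show "\<zeta> ^ (m * k) = 1" using \<zeta> by (simp add: power_mult)
    show "\<omega> ^ (m * k) = 1" using \<omega> by (simp add: power_mult mult.commute[of m])
    show "2 + \<zeta> = \<omega> * (2 + inverse \<zeta>)" using nz by (simp add: \<omega>_def)
  qed
  moreover have "\<zeta> ^ j \<noteq> 1" if "0 < j" "j < 4" for j
  proof
    assume "\<zeta> ^ j = 1"
    moreover have "exp (2 * of_real pi * \<i> * of_nat j / of_nat m) = \<zeta> ^ j"
      unfolding \<zeta>_def Complex.DeMoivre unfolding cis_conv_exp by (rule arg_cong[where f = exp]) simp
    ultimately have "exp (2 * of_real pi * \<i> * of_nat j / of_nat m) = 1" by simp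
    then have "m dvd j" using m by (subst (asm) complex_root_unity_eq_1) auto
    then show False using that m by (auto dest: dvd_imp_le)
  qed
  ultimately show False by simp
qed

text \<open>
  The quotient for \<open>1 + 2 * \<zeta>\<close> is \<open>\<zeta>\<^sup>2\<close> divided by the quotient for \<open>2 + \<zeta>\<close>, and \<open>\<zeta>\<close> is a root of unity,
  so both parts reduce to the same statement about \<open>2 + \<zeta>\<close>.
\<close>

lemma diagonal_argument_not_rational:
  fixes m :: nat
  assumes m: "m \<ge> 4" and q: "q \<in> \<rat>"
  defines "\<zeta> \<equiv> cis (2 * pi / real m)"
  shows "arccos (Re (2 + \<zeta>) / cmod (2 + \<zeta>)) \<noteq> q * pi"
    and "arccos (Re (1 + 2 * \<zeta>) / cmod (1 + 2 * \<zeta>)) \<noteq> q * pi"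
proof -
  have cnj: "cnj \<zeta> = inverse \<zeta>" by (simp add: \<zeta>_def cis_cnj)
  have nz: "a + b * \<zeta> \<noteq> 0" if "cmod a \<noteq> cmod b" for a b
    using that by (metis \<zeta>_def add_eq_0_iff norm_cis norm_minus_cancel norm_mult mult.right_neutral)
  have z: "\<zeta> \<noteq> 0" by (simp add: \<zeta>_def)
  have nz': "2 + \<zeta> \<noteq> 0" "1 + 2 * \<zeta> \<noteq> 0" using nz[of 2 1] nz[of 1 2] by auto
  have not1: "((2 + \<zeta>) / (2 + inverse \<zeta>)) ^ k \<noteq> 1" if "k > 0" for k
    unfolding \<zeta>_def using diagonal_quotient_not_root_of_unity[OF m that] .
  show "arccos (Re (2 + \<zeta>) / cmod (2 + \<zeta>)) \<noteq> q * pi"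
  proof
    assume "arccos (Re (2 + \<zeta>) / cmod (2 + \<zeta>)) = q * pi"
    from rational_argument_imp_root_of_unity[OF nz'(1) q this]
    show False using not1 by (auto simp: cnj)
  qed
  show "arccos (Re (1 + 2 * \<zeta>) / cmod (1 + 2 * \<zeta>)) \<noteq> q * pi"
  proof
    assume "arccos (Re (1 + 2 * \<zeta>) / cmod (1 + 2 * \<zeta>)) = q * pi"
    from rational_argument_imp_root_of_unity[OF nz'(2) q this]
    obtain k where k: "k > 0" "((1 + 2 * \<zeta>) / (1 + 2 * inverse \<zeta>)) ^ k = 1"
      by (auto simp: cnj)
    have "\<zeta> ^ m = 1" unfolding \<zeta>_def Complex.DeMoivre using m by simp
    have "(2 + \<zeta>) / (2 + inverse \<zeta>) = \<zeta> ^ 2 / ((1 + 2 * \<zeta>) / (1 + 2 * inverse \<zeta>))"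
    proof -
      have "2 + inverse \<zeta> = (1 + 2 * \<zeta>) / \<zeta>" "1 + 2 * inverse \<zeta> = (2 + \<zeta>) / \<zeta>"
        using z by (simp_all add: field_simps)
      then show ?thesis using z by (simp add: power2_eq_square)
    qed
    then have "((2 + \<zeta>) / (2 + inverse \<zeta>)) ^ (m * k) =
        (\<zeta> ^ m) ^ (2 * k) / (((1 + 2 * \<zeta>) / (1 + 2 * inverse \<zeta>)) ^ k) ^ m"
      by (simp only: power_divide power_mult[symmetric]) (simp add: mult_ac)
    also have "\<dots> = 1" using k \<open>\<zeta> ^ m = 1\<close> by simp
    finally show False using not1[of "m * k"] m k by simp
  qed
qed

section \<open>From the plane to the complex numbers\<close>

lemma irrational_arccosI:
  assumes "\<bar>c\<bar> \<le> 1" "\<And>q. q \<in> \<rat> \<Longrightarrow> arccos c \<noteq> q * pi"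
  shows "irrational_angle (arccos c)"
  using assms arccos_lbound[of c] arccos_ubound[of c] pi_gt_zero
  unfolding irrational_angle_def abs_le_iff by (smt (verit))

text \<open>
  Identifying the span of the two sides with the complex plane turns \<open>u + w\<close> into \<open>1 + 2 * \<zeta>\<close> when \<open>u\<close>
  is placed on the positive real axis. Placing \<open>w\<close> there instead reverses the orientation, and
  \<open>u + w\<close> becomes \<open>2 + \<zeta>\<close>.
\<close>

lemma diagonal_vector_angles_irrational:
  fixes u w :: "'a::real_inner" and m :: nat
  assumes m: "m \<ge> 4" and u: "norm u = 1" and w: "norm w = 2"
    and uw: "u \<bullet> w = 2 * cos (2 * pi / real m)"
  shows "irrational_angle (arccos ((u + w) \<bullet> u / (norm (u + w) * norm u)))"
    and "irrational_angle (arccos ((u + w) \<bullet> w / (norm (u + w) * norm w)))"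
proof -
  define \<alpha> where "\<alpha> = 2 * pi / real m"
  have uw': "u \<bullet> w = 2 * cos \<alpha>" using uw by (simp add: \<alpha>_def)
  have uu: "u \<bullet> u = 1" "w \<bullet> w = 4" using u w by (simp_all add: dot_square_norm)
  have n: "norm (u + w) = sqrt (5 + 4 * cos \<alpha>)"
    by (simp add: norm_eq_sqrt_inner inner_add uu inner_commute[of w u] uw')
  have n2: "cmod (2 + cis \<alpha>) = norm (u + w)"
  proof -
    have "(2 + cos \<alpha>)\<^sup>2 + (sin \<alpha>)\<^sup>2 = 5 + 4 * cos \<alpha>"
      using sin_cos_squared_add[of \<alpha>] by (simp add: power2_eq_square algebra_simps)
    then show ?thesis by (simp add: n cmod_def)
  qed
  have n1: "cmod (1 + 2 * cis \<alpha>) = norm (u + w)"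
  proof -
    have "(1 + 2 * cos \<alpha>)\<^sup>2 + (2 * sin \<alpha>)\<^sup>2 = 5 + 4 * cos \<alpha>"
      unfolding power_mult_distrib power2_sum sin_squared_eq by simp
    then show ?thesis by (simp add: n cmod_def)
  qed
  have 1: "(u + w) \<bullet> u / (norm (u + w) * norm u) = Re (1 + 2 * cis \<alpha>) / cmod (1 + 2 * cis \<alpha>)"
    by (simp add: n1 u inner_add uu inner_commute[of w u] uw')
  have 2: "(u + w) \<bullet> w / (norm (u + w) * norm w) = Re (2 + cis \<alpha>) / cmod (2 + cis \<alpha>)"
  proof -
    have "(u + w) \<bullet> w = 2 * (2 + cos \<alpha>)" by (simp add: inner_add uu uw')
    then show ?thesis by (simp add: n2 w del: distrib_left_numeral)
  qed
  have le: "\<bar>Re z / cmod z\<bar> \<le> 1" for z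
    using abs_Re_le_cmod[of z] by (cases "z = 0") (auto simp: abs_divide)
  show "irrational_angle (arccos ((u + w) \<bullet> u / (norm (u + w) * norm u)))"
    unfolding 1 using diagonal_argument_not_rational(2)[OF m]
    by (intro irrational_arccosI le) (simp add: \<alpha>_def)
  show "irrational_angle (arccos ((u + w) \<bullet> w / (norm (u + w) * norm w)))"
    unfolding 2 using diagonal_argument_not_rational(1)[OF m]
    by (intro irrational_arccosI le) (simp add: \<alpha>_def)
qed

text \<open>
  By the polarization identity, \<open>A C\<close> is a longer diagonal exactly when the angle at \<open>A\<close> is not
  obtuse. That selects \<open>2 * pi / n\<close> for \<open>n \<ge> 4\<close> and \<open>pi / 3 = 2 * pi / 6\<close> for \<open>n = 3\<close>.
\<close>

lemma longer_diagonal_angles_irrational: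
  fixes A B C D :: "real^2"
  assumes n: "n \<ge> 3"
    and par: "B - A = C - D"
    and edges: "edge_lengths A B C D = {1, 2}"
    and angles: "interior_angles A B C D = {2 * pi / real n, (real n - 2) * pi / real n}"
    and longer: "dist A C \<ge> dist B D"
    and th: "\<theta> \<in> diagonal_edge_angles A B C D"
  shows "irrational_angle \<theta>"
proof -
  define u w where "u = B - A" and "w = D - A"
  have B: "B = A + u" and D: "D = A + w" and C: "C = A + u + w"
    using par by (simp_all add: u_def w_def algebra_simps)
  have sides: "{norm u, norm w} = {1, 2}"
    using edges by (simp add: edge_lengths_def B C D dist_norm norm_minus_commute insert_commute insert_absorb)
  then have sides': "norm u = 1 \<and> norm w = 2 \<or> norm u = 2 \<and> norm w = 1"
    by (simp add: doubleton_eq_iff)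
  have "(norm (u + w))\<^sup>2 \<ge> (norm (u - w))\<^sup>2"
    using longer by (simp add: B C D dist_norm norm_minus_commute algebra_simps)
  then have acute: "u \<bullet> w \<ge> 0"
    by (simp add: power2_norm_eq_inner inner_add inner_diff inner_commute)
  have uw_le: "u \<bullet> w / 2 \<le> 1"
    using norm_cauchy_schwarz[of u w] sides' by auto
  define \<phi> where "\<phi> = arccos (u \<bullet> w / 2)"
  have cos\<phi>: "u \<bullet> w = 2 * cos \<phi>" using acute uw_le by (simp add: \<phi>_def)
  have \<phi>_le: "\<phi> \<le> pi / 2"
    unfolding \<phi>_def by (rule arccos_le_pi2) (use acute uw_le in simp_all)
  have "\<phi> = vertex_angle D A B"
    using sides' by (auto simp: vertex_angle_def \<phi>_def B D inner_commute)
  then have "\<phi> \<in> {2 * pi / real n, (real n - 2) * pi / real n}"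
    unfolding angles[symmetric] by (simp add: interior_angles_def)
  then obtain m :: nat where m: "m \<ge> 4" "\<phi> = 2 * pi / real m"
  proof
    assume e: "\<phi> = 2 * pi / real n"
    have "4 * pi \<le> real n * pi" using \<phi>_le n unfolding e by (simp add: field_simps)
    then have "n \<ge> 4" by simp
    then show thesis using e that by blast
  next
    assume "\<phi> \<in> {(real n - 2) * pi / real n}"
    then have e: "\<phi> = (real n - 2) * pi / real n" by simp
    have "(2 * (real n - 2)) * pi \<le> real n * pi"
      using \<phi>_le n unfolding e by (simp add: field_simps)
    then have "n \<le> 4" by simp
    then consider "n = 3" | "n = 4" using n by linarith
    then show thesis
    proof cases
      case 1
      then show thesis using e that[of 6] by simp
    next
      case 2
      then show thesis using e that[of 4] by simp
    qed
  qed
  have irr: "irrational_angle (arccos ((u + w) \<bullet> u / (norm (u + w) * norm u)))"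
    "irrational_angle (arccos ((u + w) \<bullet> w / (norm (u + w) * norm w)))"
    using sides' diagonal_vector_angles_irrational[OF m(1), of u w]
      diagonal_vector_angles_irrational[OF m(1), of w u] cos\<phi> m(2)
    by (auto simp: add.commute inner_commute)
  have reversed: "norm (- u - w) = norm (u + w)" "(- u - w) \<bullet> (- x) = (u + w) \<bullet> x" for x
    using norm_minus_cancel[of "u + w"] by (simp_all add: inner_diff inner_add)
  have "vertex_angle C A B = arccos ((u + w) \<bullet> u / (norm (u + w) * norm u))"
    "vertex_angle A C D = arccos ((u + w) \<bullet> u / (norm (u + w) * norm u))"
    "vertex_angle C A D = arccos ((u + w) \<bullet> w / (norm (u + w) * norm w))"
    "vertex_angle A C B = arccos ((u + w) \<bullet> w / (norm (u + w) * norm w))"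
    by (simp_all add: vertex_angle_def B C D reversed algebra_simps)
  then show ?thesis using th irr by (auto simp: diagonal_edge_angles_def)
qed

theorem theorem5:
  fixes n :: nat and A B C D :: "real^2"
  assumes "n \<ge> 3"
    and "parallelogram A B C D"
    and "edge_lengths A B C D = {1, 2}"
    and "interior_angles A B C D = {2 * pi / real n, (real n - 2) * pi / real n}"
  shows "(dist A C \<ge> dist B D \<longrightarrow> (\<forall>\<theta>\<in>diagonal_edge_angles A B C D. irrational_angle \<theta>)) \<and>
         (dist B D \<ge> dist A C \<longrightarrow> (\<forall>\<theta>\<in>diagonal_edge_angles B C D A. irrational_angle \<theta>))"
proof -
  have par: "B - A = C - D" using assms(2) by (simp add: parallelogram_def)
  then have par': "C - B = D - A" by (simp add: algebra_simps)
  have "edge_lengths B C D A = edge_lengths A B C D"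
    by (auto simp: edge_lengths_def)
  then have edges: "edge_lengths B C D A = {1, 2}" using assms(3) by simp
  have "interior_angles B C D A = interior_angles A B C D"
    by (auto simp: interior_angles_def)
  then have angles: "interior_angles B C D A = {2 * pi / real n, (real n - 2) * pi / real n}"
    using assms(4) by simp
  show ?thesis
    using longer_diagonal_angles_irrational[OF assms(1) par assms(3,4)]
      longer_diagonal_angles_irrational[OF assms(1) par' edges angles]
    by (auto simp: dist_commute)
qed

end
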